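(* Let $n\ge 1$, $d\ge 1$, and let $F_1,\dots,F_d$ be real-valued homogeneous polynomials on $\mathbb{R}^n$ such that, for every $i=1,\dots,d$, there is an integer $k_i\ge 1$ with $F_i\in\mathrm{Ker}(\mathcal{L}+k_i I)$, and such that $\int_{\mathbb{R}^n}F_i^2\,d\gamma_n=1$ for all $i\in\{1,\dots,d\}$. Set $K=k_1+\cdots+k_d$ and $$\mathcal{S}_i=\sup_{x\in S^{n-1}}|F_i(x)|,\qquad \mathcal{S}=\sup_{x\in S^{n-1}}\prod_{i=1}^d|F_i(x)|.$$ Then $$\mathcal{S}\,\sqrt{\frac{2^K\,\Gamma\!\left(K+\frac n2\right)}{\Gamma\!\left(\frac n2\right)\prod_{i=1}^d k_i!}}\ \ge\ \prod_{i=1}^d\mathcal{S}_i.$$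
   Context: $\gamma_n$ is the standard Gaussian measure on $\mathbb{R}^n$, $d\gamma_n(x)=(2\pi)^{-n/2}e^{-\|x\|^2/2}dx$. $\mathcal{L}f=\Delta f-\langle x,\nabla f\rangle$ is the Ornstein-Uhlenbeck generator on $\mathbb{R}^n$ and $I$ is the identity operator; thus $F\in\mathrm{Ker}(\mathcal{L}+kI)$ means $\mathcal{L}F=-kF$. $S^{n-1}=\{x\in\mathbb{R}^n:\|x\|=1\}$ is the Euclidean unit sphere, and $\Gamma$ is Euler's gamma function. *)

theory Defs
  imports "HOL-Analysis.Analysis"
begin

definition gauss_measure :: "(real ^ 'n) measure" where
  "gauss_measure = density lborel
     (\<lambda>x :: real ^ 'n. ennreal ((2 * pi) powr (- real CARD('n) / 2) * exp (- (norm x)\<^sup>2 / 2)))"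

definition partial_deriv :: "'n::finite \<Rightarrow> (real ^ 'n \<Rightarrow> real) \<Rightarrow> real ^ 'n \<Rightarrow> real" where
  "partial_deriv i f x = deriv (\<lambda>t. f (x + t *\<^sub>R axis i 1)) 0"

definition gradient :: "(real ^ 'n::finite \<Rightarrow> real) \<Rightarrow> real ^ 'n \<Rightarrow> real ^ 'n" where
  "gradient f x = (\<chi> i. partial_deriv i f x)"

definition laplacian :: "(real ^ 'n::finite \<Rightarrow> real) \<Rightarrow> real ^ 'n \<Rightarrow> real" where
  "laplacian f x = (\<Sum>i\<in>UNIV. partial_deriv i (partial_deriv i f) x)"

definition OU :: "(real ^ 'n::finite \<Rightarrow> real) \<Rightarrow> real ^ 'n \<Rightarrow> real" where
  "OU f x = laplacian f x - x \<bullet> gradient f x"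

(* A multi-index is a function 'n => nat; those of total degree m form a finite set
   (finite_multi_indices below), so the sum is a genuine finite sum.  As usual, the zero
   polynomial counts as homogeneous of every degree. *)
definition homogeneous_polynomial :: "(real ^ 'n::finite \<Rightarrow> real) \<Rightarrow> bool" where
  "homogeneous_polynomial f \<longleftrightarrow>
     (\<exists>(m::nat) (c :: ('n \<Rightarrow> nat) \<Rightarrow> real). \<forall>x.
        f x = (\<Sum>\<alpha> | (\<Sum>j\<in>UNIV. \<alpha> j) = m. c \<alpha> * (\<Prod>j\<in>UNIV. (x $ j) ^ \<alpha> j)))"

lemma finite_multi_indices: "finite {\<alpha> :: 'n::finite \<Rightarrow> nat. (\<Sum>j\<in>UNIV. \<alpha> j) = m}"
proof (rule finite_subset)
  have "\<alpha> j \<le> (\<Sum>j\<in>UNIV. \<alpha> j)" for \<alpha> :: "'n \<Rightarrow> nat" and j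
    by (rule member_le_sum) auto
  then show "{\<alpha> :: 'n \<Rightarrow> nat. (\<Sum>j\<in>UNIV. \<alpha> j) = m} \<subseteq> (UNIV \<rightarrow>\<^sub>E {..m})"
    by (auto simp: PiE_def)
  show "finite ((UNIV :: 'n set) \<rightarrow>\<^sub>E {..m})"
    by (intro finite_PiE) auto
qed

end

theory Submission
  imports Defs "HOL-Probability.Distributions"
begin

text \<open>An eigenfunction of the Ornstein-Uhlenbeck operator that is a homogeneous polynomial is a
  harmonic form whose degree is its eigenvalue (\<open>OU_eigenfunction_form\<close>). So the statement is about
  harmonic forms $F_1, \dots, F_d$ of degrees $k_1, \dots, k_d$, and the right tool is the Fischer inner
  product $\langle f, g \rangle = f(\partial) g$ on forms of degree $k$, for which multiplication by a
  coordinate is adjoint to differentiation in that coordinate. In coordinates, the monomials are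
  orthogonal and $x^\alpha$ has squared norm $\alpha!$.

  Three properties of the Fischer norm carry the proof.

  \<^item> It controls the values on the sphere: $k! \, f(x)^2 \le \|x\|^{2k} \langle f, f \rangle$, by Euler's
    identity and the Cauchy-Schwarz inequality (\<open>form_le_fischer\<close>).

  \<^item> It is at most the norm in $L^2(\gamma_n)$, with equality for harmonic forms
    (\<open>fischer_le_gauss\<close>, \<open>harmonic_gauss_eq_fischer\<close>). Both facts rest on Gaussian integration by parts.

  \<^item> It is supermultiplicative: $\|p q\| \ge \|p\| \, \|q\|$ for all forms $p$ and $q$ (\<open>fischer_mult_ge\<close>).
    In another normalisation this is the inequality of Beauzamy, Bombieri, Enflo and Montgomery.

  Let $P = \prod_i F_i$, a form of degree $K$. Since the $F_i$ are harmonic, their Fischer norms are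
  $1$, whence $\mathcal{S}_i \le 1 / \sqrt{k_i!}$, and
  \[ 1 = \prod_i \|F_i\|^2 \le \|P\|^2 \le \int P^2 \, d\gamma_n
       \le \mathcal{S}^2 \int \|x\|^{2K} \, d\gamma_n
       = \mathcal{S}^2 \, \frac{2^K \Gamma(K + n/2)}{\Gamma(n/2)}. \]
  Dividing the square root of this estimate by $\prod_i \sqrt{k_i!}$ gives the theorem.\<close>

section \<open>Forms and their partial derivatives\<close>

definition monomial :: "('n::finite \<Rightarrow> nat) \<Rightarrow> real ^ 'n \<Rightarrow> real" where
  "monomial \<alpha> x = (\<Prod>j\<in>UNIV. (x $ j) ^ \<alpha> j)"

text \<open>The span of the monomials of degree $k$, generated so that linear facts about forms need to be
  checked only on a multiple of one monomial. The zero function belongs to every degree.\<close>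

inductive form :: "nat \<Rightarrow> (real ^ 'n::finite \<Rightarrow> real) \<Rightarrow> bool" where
  monomial: "sum \<alpha> UNIV = k \<Longrightarrow> form k (\<lambda>x. c * monomial \<alpha> x)"
| add: "form k f \<Longrightarrow> form k g \<Longrightarrow> form k (\<lambda>x. f x + g x)"

lemma form_zero: "form k (\<lambda>x. 0)"
proof -
  obtain i :: 'a where True by blast
  have "sum (\<lambda>j. if j = i then k else 0) UNIV = k" by simp
  from form.monomial[OF this, of 0] show ?thesis by simp
qed

lemma form_sum: "(\<And>a. a \<in> A \<Longrightarrow> form k (f a)) \<Longrightarrow> form k (\<lambda>x. \<Sum>a\<in>A. f a x)"
  by (induction A rule: infinite_finite_induct) (auto intro: form_zero form.add)

lemma form_cmult: "form k f \<Longrightarrow> form k (\<lambda>x. a * f x)"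
proof (induction rule: form.induct)
  case (monomial \<alpha> k c)
  from form.monomial[OF this, of "a * c"] show ?case by (simp add: mult.assoc)
qed (simp add: form.add distrib_left)

lemma form_const: "form 0 (\<lambda>x. a)"
  using form.monomial[of "\<lambda>_. 0" 0 a] by (simp add: monomial_def)

lemma form_mult: "form k f \<Longrightarrow> form l g \<Longrightarrow> form (k + l) (\<lambda>x. f x * g x)"
proof (induction rule: form.induct)
  case (monomial \<alpha> k a)
  from \<open>form l g\<close> show ?case
  proof (induction rule: form.induct)
    case (monomial \<beta> l b)
    have "sum (\<lambda>j. \<alpha> j + \<beta> j) UNIV = k + l"
      using monomial \<open>sum \<alpha> UNIV = k\<close> by (simp add: sum.distrib)
    from form.monomial[OF this, of "a * b"] show ?case
      by (simp add: monomial_def power_add prod.distrib mult_ac)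
  qed (simp add: form.add distrib_left)
qed (simp add: form.add distrib_right)

lemma form_prod:
  "(\<And>a. a \<in> A \<Longrightarrow> form (k a) (f a)) \<Longrightarrow> form (sum k A) (\<lambda>x. \<Prod>a\<in>A. f a x)"
  by (induction A rule: infinite_finite_induct) (auto intro: form_const form_mult)

lemma form_coord: "form 1 (\<lambda>x. x $ i)"
proof -
  have "monomial (\<lambda>j. if j = i then 1 else 0) x = x $ i" for x :: "real ^ 'a"
    by (simp add: monomial_def if_distrib[of "power _"] cong: if_cong)
  then show ?thesis
    using form.monomial[of "\<lambda>j. if j = i then 1 else 0" 1 1] by simp
qed

lemma form_coord_mult: "form k f \<Longrightarrow> form (Suc k) (\<lambda>x. x $ i * f x)"
  using form_mult[OF form_coord] by simp

lemma form_0_eq: "form k f \<Longrightarrow> k = 0 \<Longrightarrow> f x = f 0"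
  by (induction rule: form.induct) (auto simp: monomial_def)

lemma form_0_mult: "form 0 p \<Longrightarrow> (\<lambda>x. p x * q x) = (\<lambda>x. p 0 * q x)"
  by (metis form_0_eq)

lemma form_scale: "form k f \<Longrightarrow> f (t *\<^sub>R x) = t ^ k * f x"
proof (induction rule: form.induct)
  case (monomial \<alpha> k c)
  have "t ^ k = (\<Prod>j\<in>UNIV. t ^ \<alpha> j)"
    using monomial power_sum by metis
  then show ?case
    by (simp add: monomial_def power_mult_distrib prod.distrib mult_ac)
qed (simp add: distrib_left)

lemma DERIV_monomial:
  "((\<lambda>t. monomial \<alpha> (x + t *\<^sub>R axis i 1)) has_field_derivative
     real (\<alpha> i) * monomial (\<alpha>(i := \<alpha> i - 1)) x) (at 0)"
proof -
  \<comment> \<open>Only the factor with index $i$ depends on $t$.\<close>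
  define r where "r = (\<Prod>j\<in>UNIV - {i}. (x $ j) ^ \<alpha> j)"
  have 1: "monomial \<alpha> (x + t *\<^sub>R axis i 1) = (x $ i + t) ^ \<alpha> i * r" for t
    unfolding monomial_def r_def
    by (subst prod.remove[of _ i]) (auto simp: axis_def intro!: prod.cong)
  have 2: "monomial (\<alpha>(i := \<alpha> i - 1)) x = (x $ i) ^ (\<alpha> i - 1) * r"
    unfolding monomial_def r_def
    by (subst prod.remove[of _ i]) (auto intro!: prod.cong)
  show ?thesis
    unfolding 1 2 by (auto intro!: derivative_eq_intros)
qed

lemma partial_deriv_eqI:
  "((\<lambda>t. f (x + t *\<^sub>R axis i 1)) has_field_derivative D) (at 0) \<Longrightarrow> partial_deriv i f x = D"
  unfolding partial_deriv_def by (rule DERIV_imp_deriv)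

text \<open>The derivative \<open>deriv\<close> is an arbitrary value where a function is not differentiable, so the
  usual rules for partial derivatives hold for forms only after this lemma.\<close>

lemma DERIV_form:
  assumes "form k f"
  shows "((\<lambda>t. f (x + t *\<^sub>R axis i 1)) has_field_derivative partial_deriv i f x) (at 0)"
proof -
  from assms have "\<exists>D. ((\<lambda>t. f (x + t *\<^sub>R axis i 1)) has_field_derivative D) (at 0)"
  proof (induction rule: form.induct)
    case (monomial \<alpha> k c)
    show ?case using DERIV_cmult[OF DERIV_monomial] by blast
  next
    case (add k f g)
    then show ?case using DERIV_add by blast
  qed
  then show ?thesis using partial_deriv_eqI[of f] by blast
qed

lemma partial_deriv_monomial:
  "partial_deriv i (\<lambda>x. c * monomial \<alpha> x) = (\<lambda>x. c * real (\<alpha> i) * monomial (\<alpha>(i := \<alpha> i - 1)) x)"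
  by (rule ext, rule partial_deriv_eqI)
    (use DERIV_cmult[OF DERIV_monomial, of c] in \<open>simp add: mult.assoc\<close>)

lemma partial_deriv_add:
  "form k f \<Longrightarrow> form l g \<Longrightarrow>
    partial_deriv i (\<lambda>x. f x + g x) = (\<lambda>x. partial_deriv i f x + partial_deriv i g x)"
  by (rule ext, rule partial_deriv_eqI) (intro DERIV_add DERIV_form)

lemma partial_deriv_mult:
  assumes "form k f" "form l g"
  shows "partial_deriv i (\<lambda>x. f x * g x) =
    (\<lambda>x. partial_deriv i f x * g x + f x * partial_deriv i g x)"
  by (rule ext, rule partial_deriv_eqI)
    (use DERIV_mult[OF DERIV_form[OF assms(1)] DERIV_form[OF assms(2)]]
     in \<open>simp add: algebra_simps\<close>)

lemma partial_deriv_const: "partial_deriv i (\<lambda>x. c) = (\<lambda>x. 0)"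
  by (rule ext, rule partial_deriv_eqI) simp

lemma partial_deriv_cmult:
  "form k f \<Longrightarrow> partial_deriv i (\<lambda>x. a * f x) = (\<lambda>x. a * partial_deriv i f x)"
  by (subst partial_deriv_mult[OF form_const]) (simp_all add: partial_deriv_const)

lemma partial_deriv_sum:
  assumes "finite A" "\<And>a. a \<in> A \<Longrightarrow> form k (f a)"
  shows "partial_deriv i (\<lambda>x. \<Sum>a\<in>A. f a x) = (\<lambda>x. \<Sum>a\<in>A. partial_deriv i (f a) x)"
  using assms
proof (induction A)
  case empty
  then show ?case by (simp add: partial_deriv_const)
next
  case (insert a A)
  have "partial_deriv i (\<lambda>x. f a x + (\<Sum>a\<in>A. f a x)) =
      (\<lambda>x. partial_deriv i (f a) x + partial_deriv i (\<lambda>x. \<Sum>a\<in>A. f a x) x)"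
    by (rule partial_deriv_add[of k _ k]) (auto intro: insert form_sum)
  then show ?case using insert by simp
qed

lemma partial_deriv_coord:
  "partial_deriv i (\<lambda>x. x $ j) = (\<lambda>x. if i = j then 1 else 0)"
  by (rule ext, rule partial_deriv_eqI)
    (auto simp: axis_def intro!: derivative_eq_intros)

lemma partial_deriv_coord_mult:
  assumes "form k f"
  shows "partial_deriv j (\<lambda>x. x $ i * f x) =
    (\<lambda>x. (if j = i then f x else 0) + x $ i * partial_deriv j f x)"
  by (subst partial_deriv_mult[OF form_coord assms]) (simp add: partial_deriv_coord fun_eq_iff)

text \<open>Truncated subtraction is harmless here: the derivative of a form of degree $0$ is the
  zero form, which has every degree.\<close>

lemma form_partial_deriv: "form k f \<Longrightarrow> form (k - 1) (partial_deriv i f)"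
proof (induction rule: form.induct)
  case (monomial \<alpha> k c)
  show ?case
  proof (cases "\<alpha> i = 0")
    case True
    then show ?thesis by (simp add: partial_deriv_monomial form_zero)
  next
    case False
    have "sum (\<alpha>(i := \<alpha> i - 1)) UNIV = k - 1"
      using monomial False by (simp add: sum.remove[of UNIV i] sum.remove[of UNIV i \<alpha>])
    then show ?thesis
      unfolding partial_deriv_monomial by (rule form.monomial)
  qed
next
  case (add k f g)
  then show ?case by (simp add: partial_deriv_add[of k f k g] form.add)
qed

lemma form_Suc_partial_deriv: "form (Suc k) f \<Longrightarrow> form k (partial_deriv i f)"
  using form_partial_deriv[of "Suc k" f i] by simp

lemma partial_deriv_form_0: "form 0 f \<Longrightarrow> partial_deriv i f = (\<lambda>x. 0)"
  using form_0_eq[of 0 f] partial_deriv_const[of i "f 0"] by (metis ext)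

lemma partial_deriv_commute:
  "form k f \<Longrightarrow>
    partial_deriv i (partial_deriv j f) = partial_deriv j (partial_deriv i f)"
proof (induction rule: form.induct)
  case (monomial \<alpha> k c)
  then show ?case
    unfolding partial_deriv_monomial
    by (cases "i = j") (simp_all add: fun_upd_twist mult_ac)
next
  case (add k f g)
  then show ?case
    by (simp add: partial_deriv_add[of k f k g]
        partial_deriv_add[OF form_partial_deriv form_partial_deriv, of k f k g])
qed

lemma Euler_identity:
  "form k f \<Longrightarrow> (\<Sum>i\<in>UNIV. x $ i * partial_deriv i f x) = real k * f x"
proof (induction rule: form.induct)
  case (monomial \<alpha> k c)
  have "x $ i * (c * real (\<alpha> i) * monomial (\<alpha>(i := \<alpha> i - 1)) x) = real (\<alpha> i) * (c * monomial \<alpha> x)"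
    for i
  proof (cases "\<alpha> i = 0")
    case False
    have "x $ i * monomial (\<alpha>(i := \<alpha> i - 1)) x = monomial \<alpha> x"
      unfolding monomial_def
      using False by (simp add: prod.remove[of UNIV i] power_eq_if[of _ "\<alpha> i"])
    then show ?thesis by (simp add: algebra_simps)
  qed simp
  then have "(\<Sum>i\<in>UNIV. x $ i * partial_deriv i (\<lambda>x. c * monomial \<alpha> x) x) =
      (\<Sum>i\<in>UNIV. real (\<alpha> i) * (c * monomial \<alpha> x))"
    unfolding partial_deriv_monomial by (intro sum.cong refl)
  then show ?case using monomial
    by (simp flip: sum_distrib_right of_nat_sum)
next
  case (add k f g)
  then show ?case by (simp add: partial_deriv_add[of k f k g] distrib_left sum.distrib)
qed

lemma homogeneous_polynomial_imp_form: "homogeneous_polynomial f \<Longrightarrow> \<exists>m. form m f"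
proof -
  assume "homogeneous_polynomial f"
  then obtain m c where
    "f = (\<lambda>x. \<Sum>\<alpha> | (\<Sum>j\<in>UNIV. \<alpha> j) = m. c \<alpha> * monomial \<alpha> x)"
    unfolding homogeneous_polynomial_def monomial_def by blast
  moreover have "form m \<dots>"
    by (intro form_sum form.monomial) simp
  ultimately show ?thesis by blast
qed

section \<open>The Fischer inner product\<close>

text \<open>This is $f(\partial) g$ for forms $f$ and $g$ of degree $k$, that is
  $\frac{1}{k!} \sum \partial_{i_1} \cdots \partial_{i_k} f \cdot \partial_{i_1} \cdots \partial_{i_k} g$
  with the sum over all index sequences of length $k$. Peeling off one index at a time avoids
  multi-indices: an induction on $k$ meets only first derivatives, which Euler's identity reassembles.\<close>

primrec fischer :: "nat \<Rightarrow> (real ^ 'n::finite \<Rightarrow> real) \<Rightarrow> (real ^ 'n \<Rightarrow> real) \<Rightarrow> real" where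
  "fischer 0 f g = f 0 * g 0"
| "fischer (Suc k) f g =
    (\<Sum>i\<in>UNIV. fischer k (partial_deriv i f) (partial_deriv i g)) / real (Suc k)"

lemma fischer_commute: "fischer k f g = fischer k g f"
  by (induction k arbitrary: f g) (simp_all add: mult.commute)

lemma fischer_self_nonneg: "fischer k f f \<ge> 0"
  by (induction k arbitrary: f) (auto intro!: divide_nonneg_pos sum_nonneg)

lemma fischer_add_left:
  "form k f \<Longrightarrow> form k g \<Longrightarrow> fischer k (\<lambda>x. f x + g x) h = fischer k f h + fischer k g h"
proof (induction k arbitrary: f g h)
  case (Suc k)
  show ?case
    using Suc by (simp add: partial_deriv_add[of "Suc k" f "Suc k" g] form_Suc_partial_deriv
        sum.distrib add_divide_distrib del: of_nat_Suc)
qed (simp add: distrib_right)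

lemma fischer_zero_left: "fischer k (\<lambda>x. 0) h = 0"
  by (induction k arbitrary: h) (simp_all add: partial_deriv_const)

lemma fischer_sum_left:
  assumes "\<And>a. a \<in> A \<Longrightarrow> form k (f a)"
  shows "fischer k (\<lambda>x. \<Sum>a\<in>A. f a x) h = (\<Sum>a\<in>A. fischer k (f a) h)"
  using assms
  by (induction A rule: infinite_finite_induct)
    (simp_all add: fischer_zero_left fischer_add_left form_sum)

lemma fischer_cmult_left:
  "form k f \<Longrightarrow> fischer k (\<lambda>x. a * f x) h = a * fischer k f h"
proof (induction k arbitrary: f h)
  case (Suc k)
  then show ?case
    by (simp add: partial_deriv_cmult[of "Suc k" f] form_Suc_partial_deriv
        flip: sum_distrib_left)
qed simp

text \<open>After one derivative in every direction the product rule produces the right-hand side once,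
  from the derivative of the
  coordinate, and $k$ times more from the other term, by the induction hypothesis and the recursion
  for the product of degree $k$.\<close>

lemma fischer_coord_mult_left:
  assumes "form k f" "form (Suc k) g"
  shows "fischer (Suc k) (\<lambda>x. x $ i * f x) g = fischer k f (partial_deriv i g)"
  using assms
proof (induction k arbitrary: f g)
  case 0
  have "partial_deriv j (\<lambda>x. x $ i * f x) 0 = (if j = i then f 0 else 0)" for j
    by (simp add: partial_deriv_coord_mult[OF 0(1)])
  then show ?case by (simp add: if_distrib[of "\<lambda>z. z * _"] cong: if_cong)
next
  case (Suc k)
  note D = form_Suc_partial_deriv
  have *: "fischer (Suc k) (partial_deriv j (\<lambda>x. x $ i * f x)) (partial_deriv j g) =
      (if j = i then fischer (Suc k) f (partial_deriv j g) else 0) +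
      fischer k (partial_deriv j f) (partial_deriv j (partial_deriv i g))" for j
  proof -
    have 1: "form (Suc k) (\<lambda>x. if j = i then f x else 0)"
      using Suc.prems(1) by (cases "j = i") (auto intro: form_zero)
    have 2: "form (Suc k) (\<lambda>x. x $ i * partial_deriv j f x)"
      using Suc.prems(1) by (intro form_coord_mult D)
    have "fischer (Suc k) (partial_deriv j (\<lambda>x. x $ i * f x)) (partial_deriv j g) =
        fischer (Suc k) (\<lambda>x. if j = i then f x else 0) (partial_deriv j g) +
        fischer (Suc k) (\<lambda>x. x $ i * partial_deriv j f x) (partial_deriv j g)"
      unfolding partial_deriv_coord_mult[OF Suc.prems(1)] by (rule fischer_add_left[OF 1 2])
    also have "fischer (Suc k) (\<lambda>x. x $ i * partial_deriv j f x) (partial_deriv j g) =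
        fischer k (partial_deriv j f) (partial_deriv i (partial_deriv j g))"
      using Suc.prems by (intro Suc.IH D)
    also have "partial_deriv i (partial_deriv j g) = partial_deriv j (partial_deriv i g)"
      by (rule partial_deriv_commute[OF Suc.prems(2)])
    finally show ?thesis by (cases "j = i") (simp_all add: fischer_zero_left del: fischer.simps)
  qed
  have "real (Suc (Suc k)) * fischer (Suc (Suc k)) (\<lambda>x. x $ i * f x) g =
      fischer (Suc k) f (partial_deriv i g) +
      (\<Sum>j\<in>UNIV. fischer k (partial_deriv j f) (partial_deriv j (partial_deriv i g)))"
    by (subst fischer.simps(2)) (simp add: * sum.distrib del: fischer.simps)
  also have "(\<Sum>j\<in>UNIV. fischer k (partial_deriv j f) (partial_deriv j (partial_deriv i g))) =
      real (Suc k) * fischer (Suc k) f (partial_deriv i g)"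
    by simp
  finally show ?case
    by (metis (no_types, lifting) distrib_right mult_cancel_left of_nat_Suc of_nat_neq_0 mult_1 add.commute)
qed

text \<open>Euler's identity says $k f(x) = \langle x, \nabla f(x) \rangle$; the Cauchy-Schwarz inequality
  then reduces the bound for $f$ to the bounds for its partial derivatives.\<close>

lemma form_le_fischer:
  "form k f \<Longrightarrow> fact k * (f x)\<^sup>2 \<le> norm x ^ (2 * k) * fischer k f f"
proof (induction k arbitrary: f)
  case 0
  then show ?case using form_0_eq[of 0 f x] by (simp add: power2_eq_square)
next
  case (Suc k)
  have *: "real (Suc k) * f x = x \<bullet> (\<chi> i. partial_deriv i f x)"
    using Euler_identity[OF Suc.prems, of x] by (simp add: inner_vec_def)
  have "(real (Suc k) * f x)\<^sup>2 \<le> (norm x * norm (\<chi> i. partial_deriv i f x))\<^sup>2"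
    unfolding * by (metis Cauchy_Schwarz_ineq2 abs_ge_zero power2_abs power_mono)
  also have "\<dots> = (norm x)\<^sup>2 * (\<Sum>i\<in>UNIV. (partial_deriv i f x)\<^sup>2)"
    by (simp add: power_mult_distrib norm_vec_def L2_set_def sum_nonneg)
  finally have "fact k * (real (Suc k) * f x)\<^sup>2 \<le>
      (norm x)\<^sup>2 * (\<Sum>i\<in>UNIV. fact k * (partial_deriv i f x)\<^sup>2)"
    by (simp add: mult_left_mono mult.left_commute flip: sum_distrib_left)
  also have "\<dots> \<le> (norm x)\<^sup>2 * (\<Sum>i\<in>UNIV. norm x ^ (2 * k) * fischer k (partial_deriv i f) (partial_deriv i f))"
    by (intro mult_left_mono sum_mono Suc.IH form_Suc_partial_deriv Suc.prems) simp
  also have "\<dots> = real (Suc k) * (norm x ^ (2 * Suc k) * fischer (Suc k) f f)"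
    by (simp add: power2_eq_square flip: sum_distrib_left)
  finally have "real (Suc k) * (fact (Suc k) * (f x)\<^sup>2) \<le> real (Suc k) * (norm x ^ (2 * Suc k) * fischer (Suc k) f f)"
    by (simp add: power2_eq_square mult_ac)
  then show ?case by (rule mult_left_le_imp_le) simp
qed

section \<open>The Fischer norm is supermultiplicative\<close>

text \<open>The sum of $\partial_{i_1} \cdots \partial_{i_m} p \,(0) \cdot \partial_{i_1} \cdots \partial_{i_m} f$
  over all index sequences of length $m$. For a form $p$ of degree $m$ this is $m! \, p(\partial) f$.\<close>

primrec contract :: "nat \<Rightarrow> (real ^ 'n::finite \<Rightarrow> real) \<Rightarrow> (real ^ 'n \<Rightarrow> real) \<Rightarrow> real ^ 'n \<Rightarrow> real" where
  "contract 0 p f = (\<lambda>x. p 0 * f x)"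
| "contract (Suc m) p f = (\<lambda>x. \<Sum>i\<in>UNIV. contract m (partial_deriv i p) (partial_deriv i f) x)"

lemma form_contract: "form (m + l) f \<Longrightarrow> form l (contract m p f)"
  by (induction m arbitrary: p f)
    (auto intro!: form_cmult form_sum form_Suc_partial_deriv)

text \<open>Since \<open>contract\<close> is $m! \, p(\partial)$, this is the adjointness for a single coordinate, iterated
  along the expansion of $p$ given by Euler's identity.\<close>

lemma fischer_mult_left:
  "form m p \<Longrightarrow> form l h \<Longrightarrow> form (m + l) f \<Longrightarrow>
    fact m * fischer (m + l) (\<lambda>x. p x * h x) f = fischer l h (contract m p f)"
proof (induction m arbitrary: p f)
  case 0
  then show ?case
    using fischer_cmult_left[of l h "p 0" f] fischer_cmult_left[of l f "p 0" h]
    by (simp add: form_0_mult[of p] fischer_commute[of l h])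
next
  case (Suc m)
  note D = form_Suc_partial_deriv
  have F: "form (Suc (m + l)) f"
    using Suc.prems by simp
  have I: "form (m + l) (\<lambda>x. partial_deriv i p x * h x)" for i
    by (intro form_mult D Suc.prems)
  have "real (Suc m) * fischer (Suc m + l) (\<lambda>x. p x * h x) f =
      fischer (Suc (m + l)) (\<lambda>x. real (Suc m) * (p x * h x)) f"
    by (subst fischer_cmult_left) (use form_mult[OF Suc.prems(1,2)] in simp_all)
  also have "(\<lambda>x. real (Suc m) * (p x * h x)) = (\<lambda>x. \<Sum>i\<in>UNIV. x $ i * (partial_deriv i p x * h x))"
    using Euler_identity[OF Suc.prems(1)]
    by (simp add: fun_eq_iff flip: mult.assoc sum_distrib_right)
  also have "fischer (Suc (m + l)) \<dots> f =
      (\<Sum>i\<in>UNIV. fischer (Suc (m + l)) (\<lambda>x. x $ i * (partial_deriv i p x * h x)) f)"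
    by (rule fischer_sum_left) (intro form_coord_mult I)
  also have "\<dots> = (\<Sum>i\<in>UNIV. fischer (m + l) (\<lambda>x. partial_deriv i p x * h x) (partial_deriv i f))"
    by (intro sum.cong refl fischer_coord_mult_left I F)
  finally have "fact m * (real (Suc m) * fischer (Suc m + l) (\<lambda>x. p x * h x) f) =
      (\<Sum>i\<in>UNIV. fact m * fischer (m + l) (\<lambda>x. partial_deriv i p x * h x) (partial_deriv i f))"
    by (simp only: sum_distrib_left)
  then have "fact (Suc m) * fischer (Suc m + l) (\<lambda>x. p x * h x) f =
      (\<Sum>i\<in>UNIV. fact m * fischer (m + l) (\<lambda>x. partial_deriv i p x * h x) (partial_deriv i f))"
    by (simp only: fact_Suc of_nat_mult mult.assoc mult.left_commute[of "fact m"])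
  also have "\<dots> = (\<Sum>i\<in>UNIV. fischer l h (contract m (partial_deriv i p) (partial_deriv i f)))"
    by (intro sum.cong refl Suc.IH D Suc.prems F)
  also have "\<dots> = fischer l h (contract (Suc m) p f)"
    by (subst (1 2) fischer_commute)
      (simp, intro fischer_sum_left[symmetric] form_contract D F)
  finally show ?case .
qed

text \<open>The sum of
  $\langle (\partial_{i_1} \cdots \partial_{i_j} p) \, q, \; r \, (\partial_{i_1} \cdots \partial_{i_j} s) \rangle$
  over all index sequences of length $j$, with the Fischer product of degree $k$. These quantities,
  with $r = p$ and $s = q$, interpolate between $\|p q\|^2$ (for $j = 0$) and, up to a factor,
  $\|p(\partial) q\|^2$ (for $j$ the degree of $p$). The four slots are separate because the recursion
  differentiates them independently.\<close>

primrec exchange ::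
  "nat \<Rightarrow> nat \<Rightarrow> (real ^ 'n::finite \<Rightarrow> real) \<Rightarrow> (real ^ 'n \<Rightarrow> real) \<Rightarrow>
    (real ^ 'n \<Rightarrow> real) \<Rightarrow> (real ^ 'n \<Rightarrow> real) \<Rightarrow> real" where
  "exchange 0 k p q r s = fischer k (\<lambda>x. p x * q x) (\<lambda>x. r x * s x)"
| "exchange (Suc j) k p q r s = (\<Sum>i\<in>UNIV. exchange j k (partial_deriv i p) q r (partial_deriv i s))"

text \<open>When $p$ has been differentiated as often as its degree, only constants are left of it; pulling
  them into the second argument turns the derivatives of $f$ into $p(\partial) f$.\<close>

lemma exchange_full:
  assumes "form m p" "form k q" "form r h" "form (m + t) f" "k = r + t"
  shows "exchange m k p q h f = fischer k q (\<lambda>x. h x * contract m p f x)"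
  using assms(1,4)
proof (induction m arbitrary: p f)
  case 0
  have "fischer k (\<lambda>x. p x * q x) (\<lambda>x. h x * f x) = p 0 * fischer k q (\<lambda>x. h x * f x)"
    unfolding form_0_mult[OF 0(1)] by (rule fischer_cmult_left[OF assms(2)])
  also have "\<dots> = fischer k q (\<lambda>x. p 0 * (h x * f x))"
    using 0 assms(3,5)
    by (subst (1 2) fischer_commute, subst fischer_cmult_left) (auto intro: form_mult)
  finally show ?case by (simp add: mult_ac)
next
  case (Suc m)
  note D = form_Suc_partial_deriv
  have F: "form (Suc (m + t)) f"
    using Suc.prems(2) by simp
  have "exchange (Suc m) k p q h f =
      (\<Sum>i\<in>UNIV. fischer k q (\<lambda>x. h x * contract m (partial_deriv i p) (partial_deriv i f) x))"
    by (simp, intro sum.cong refl Suc.IH D Suc.prems F)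
  also have "\<dots> = fischer k q (\<lambda>x. \<Sum>i\<in>UNIV. h x * contract m (partial_deriv i p) (partial_deriv i f) x)"
    unfolding assms(5)
    by (subst (1 2) fischer_commute)
      (intro fischer_sum_left[symmetric] form_mult assms form_contract D F)
  finally show ?case by (simp add: sum_distrib_left)
qed

text \<open>Apply Euler's identity to the derivatives of $p$, which have degree $a + 1$, and move the resulting
  coordinate to the other argument of the Fischer product. There the product rule either
  falls on $h$, which gives the first sum, or on the derivatives of $f$, which gives
  the next exchange term. The degrees are written as successors so that no derivative that occurs
  has a degree truncated at zero.\<close>

lemma exchange_step:
  assumes "form (j + Suc a) p" "form l q" "form (Suc r) h" "form (j + Suc b) f"
    and "k = a + l" "k = Suc r + b"
  shows "real (Suc a) * exchange j (Suc k) p q h f =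
    (\<Sum>i\<in>UNIV. exchange j k (partial_deriv i p) q (partial_deriv i h) f) + exchange (Suc j) k p q h f"
  using assms(1,4)
proof (induction j arbitrary: p f)
  case 0
  note D = form_Suc_partial_deriv
  have P: "form (Suc a) p" and F: "form (Suc b) f"
    using 0 by simp_all
  have HF: "form (Suc k) (\<lambda>x. h x * f x)"
    using form_mult[OF assms(3) F] assms(6) by simp
  have PQ: "form k (\<lambda>x. partial_deriv i p x * q x)" for i
    unfolding assms(5) by (intro form_mult D P assms)
  have H': "form k (\<lambda>x. partial_deriv i h x * f x)" for i
    using form_mult[OF D[OF assms(3)] F] assms(6) by simp
  have F': "form k (\<lambda>x. h x * partial_deriv i f x)" for i
    using form_mult[OF assms(3) D[OF F]] assms(6) by simp
  have "real (Suc a) * fischer (Suc k) (\<lambda>x. p x * q x) (\<lambda>x. h x * f x) =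
      fischer (Suc k) (\<lambda>x. real (Suc a) * (p x * q x)) (\<lambda>x. h x * f x)"
    by (subst fischer_cmult_left) (use form_mult[OF P assms(2)] assms(5) in simp_all)
  also have "(\<lambda>x. real (Suc a) * (p x * q x)) = (\<lambda>x. \<Sum>i\<in>UNIV. x $ i * (partial_deriv i p x * q x))"
    using Euler_identity[OF P] by (simp add: fun_eq_iff flip: mult.assoc sum_distrib_right)
  also have "fischer (Suc k) \<dots> (\<lambda>x. h x * f x) =
      (\<Sum>i\<in>UNIV. fischer (Suc k) (\<lambda>x. x $ i * (partial_deriv i p x * q x)) (\<lambda>x. h x * f x))"
    by (rule fischer_sum_left) (intro form_coord_mult PQ)
  also have "\<dots> = (\<Sum>i\<in>UNIV. fischer k (\<lambda>x. partial_deriv i p x * q x)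
      (\<lambda>x. partial_deriv i h x * f x + h x * partial_deriv i f x))"
    by (simp only: fischer_coord_mult_left[OF PQ HF] partial_deriv_mult[OF assms(3) F])
  also have "\<dots> = (\<Sum>i\<in>UNIV. fischer k (\<lambda>x. partial_deriv i p x * q x) (\<lambda>x. partial_deriv i h x * f x) +
      fischer k (\<lambda>x. partial_deriv i p x * q x) (\<lambda>x. h x * partial_deriv i f x))"
    by (simp only: fischer_commute[of k "\<lambda>x. partial_deriv _ p x * q x"] fischer_add_left[OF H' F'])
  finally show ?case by (simp add: sum.distrib del: of_nat_Suc fischer.simps)
next
  case (Suc j)
  note D = form_Suc_partial_deriv
  have P: "form (Suc (j + Suc a)) p" and F: "form (Suc (j + Suc b)) f"
    using Suc.prems by simp_all
  have "real (Suc a) * exchange (Suc j) (Suc k) p q h f =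
      (\<Sum>l\<in>UNIV. (\<Sum>i\<in>UNIV. exchange j k (partial_deriv i (partial_deriv l p)) q (partial_deriv i h) (partial_deriv l f))
        + exchange (Suc j) k (partial_deriv l p) q h (partial_deriv l f))"
    unfolding exchange.simps(2)[of j "Suc k"] sum_distrib_left
    by (intro sum.cong refl Suc.IH D P F)
  also have "\<dots> = (\<Sum>i\<in>UNIV. \<Sum>l\<in>UNIV. exchange j k (partial_deriv l (partial_deriv i p)) q (partial_deriv i h) (partial_deriv l f))
        + (\<Sum>l\<in>UNIV. exchange (Suc j) k (partial_deriv l p) q h (partial_deriv l f))"
    unfolding sum.distrib by (subst sum.swap) (simp only: partial_deriv_commute[OF P])
  finally show ?case by (simp only: exchange.simps(2))
qed

text \<open>The previous recursion writes an exchange term as a positive combination of terms for the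
  derivatives of $p$ and of the term with one more exchange. Both reduce the degree $a$ that remains of
  $p$ after differentiation, and for $a = 0$ the term is $\|p(\partial) q\|^2$ up to a positive factor.\<close>

lemma exchange_nonneg:
  "form (j + a) p \<Longrightarrow> form (j + a + t) q \<Longrightarrow> exchange j (a + (j + a + t)) p q p q \<ge> 0"
proof (induction a arbitrary: j p t)
  case 0
  have P: "form j p" and Q: "form (j + t) q"
    using 0 by simp_all
  have "fact j * exchange j (j + t) p q p q =
      fact j * fischer (j + t) (\<lambda>x. p x * contract j p q x) q"
    by (simp add: exchange_full[OF P Q P Q refl] fischer_commute[of _ q])
  also have "\<dots> = fischer t (contract j p q) (contract j p q)"
    by (rule fischer_mult_left[OF P form_contract[OF Q] Q])
  finally have "fact j * exchange j (j + t) p q p q \<ge> 0"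
    by (simp add: fischer_self_nonneg)
  then have "exchange j (j + t) p q p q \<ge> 0"
    by (rule mult_left_le_imp_le[of "fact j" 0, simplified]) simp
  then show ?case by simp
next
  case (Suc a)
  define k where "k = a + (j + Suc a + t)"
  have P: "form (j + Suc a) p" and Q: "form (j + Suc a + t) q"
    using Suc.prems .
  have "real (Suc a) * exchange j (Suc k) p q p q =
      (\<Sum>i\<in>UNIV. exchange j k (partial_deriv i p) q (partial_deriv i p) q) + exchange (Suc j) k p q p q"
    by (rule exchange_step[where b = "a + t" and r = "j + a" and l = "j + Suc a + t"])
      (use P Q in \<open>simp_all add: k_def add_ac\<close>)
  also have "\<dots> \<ge> 0"
  proof (intro add_nonneg_nonneg sum_nonneg)
    fix i
    show "exchange j k (partial_deriv i p) q (partial_deriv i p) q \<ge> 0"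
      using Suc.IH[of j "partial_deriv i p" "Suc t"] P Q form_Suc_partial_deriv[of "j + a" p i]
      by (simp add: k_def add_ac)
    show "exchange (Suc j) k p q p q \<ge> 0"
      using Suc.IH[of "Suc j" p t] P Q by (simp add: k_def add_ac del: exchange.simps)
  qed
  finally have "exchange j (Suc k) p q p q \<ge> 0"
    by (simp add: zero_le_mult_iff del: of_nat_Suc)
  then show ?case by (simp add: k_def)
qed

text \<open>For $p$ of degree $m$, the recursion starting without any exchange gives
  $m \|p q\|^2 = \sum_i \|(\partial_i p) q\|^2 + {}$ an exchange term. Dropping that nonnegative term
  leaves the inequality for the derivatives of $p$. The restriction that the degree of $p$ is at
  most that of $q$ is inherited by these derivatives; it makes $p(\partial) q$ a form of degree $t$.\<close>

lemma fischer_mult_ge_aux: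
  "form m p \<Longrightarrow> form (m + t) q \<Longrightarrow>
    fischer (m + (m + t)) (\<lambda>x. p x * q x) (\<lambda>x. p x * q x) \<ge> fischer m p p * fischer (m + t) q q"
proof (induction m arbitrary: p t)
  case 0
  have "(\<lambda>x. p x * q x) = (\<lambda>x. p 0 * q x)"
    by (rule form_0_mult[OF 0(1)])
  moreover have "fischer t (\<lambda>x. p 0 * q x) (\<lambda>x. p 0 * q x) = p 0 * (p 0 * fischer t q q)"
    using 0(2) fischer_cmult_left[of t q "p 0"] fischer_commute[of t q "\<lambda>x. p 0 * q x"]
    by simp
  ultimately show ?case by simp
next
  case (Suc m)
  define k where "k = m + (Suc m + t)"
  have Q: "form (m + Suc t) q"
    using Suc.prems(2) by simp
  have "real (Suc m) * (fischer (Suc m) p p * fischer (Suc m + t) q q) =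
      (\<Sum>i\<in>UNIV. fischer m (partial_deriv i p) (partial_deriv i p) * fischer (m + Suc t) q q)"
    by (simp flip: sum_distrib_right del: fischer.simps add: fischer.simps(2)[of m p p])
  also have "\<dots> \<le> (\<Sum>i\<in>UNIV. fischer k (\<lambda>x. partial_deriv i p x * q x) (\<lambda>x. partial_deriv i p x * q x))"
    using Suc.IH[OF form_Suc_partial_deriv[OF Suc.prems(1)] Q]
    by (intro sum_mono) (simp add: k_def)
  also have "\<dots> \<le> \<dots> + exchange (Suc 0) k p q p q"
    using exchange_nonneg[of "Suc 0" m p t q] Suc.prems by (simp add: k_def)
  also have "\<dots> = real (Suc m) * exchange 0 (Suc k) p q p q"
    by (subst exchange_step[where b = "m + t" and r = m and l = "Suc m + t"])
      (use Suc.prems in \<open>simp_all add: k_def\<close>)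
  finally have "real (Suc m) * (fischer (Suc m) p p * fischer (Suc m + t) q q)
      \<le> real (Suc m) * fischer (Suc k) (\<lambda>x. p x * q x) (\<lambda>x. p x * q x)"
    by (simp only: exchange.simps)
  then have "fischer (Suc m) p p * fischer (Suc m + t) q q
      \<le> fischer (Suc k) (\<lambda>x. p x * q x) (\<lambda>x. p x * q x)"
    by (rule mult_left_le_imp_le) simp
  then show ?case by (simp only: k_def add_Suc)
qed

theorem fischer_mult_ge:
  assumes "form m p" "form l q"
  shows "fischer (m + l) (\<lambda>x. p x * q x) (\<lambda>x. p x * q x) \<ge> fischer m p p * fischer l q q"
proof (cases "m \<le> l")
  case True
  then show ?thesis
    using fischer_mult_ge_aux[of m p "l - m" q] assms by simp
next
  case False
  then show ?thesis
    using fischer_mult_ge_aux[of l q "m - l" p] assms by (simp add: mult.commute add.commute)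
qed

lemma fischer_prod_ge:
  assumes "finite A" "\<And>a. a \<in> A \<Longrightarrow> form (k a) (f a)"
  shows "fischer (sum k A) (\<lambda>x. \<Prod>a\<in>A. f a x) (\<lambda>x. \<Prod>a\<in>A. f a x) \<ge>
    (\<Prod>a\<in>A. fischer (k a) (f a) (f a))"
  using assms
proof (induction A)
  case (insert a A)
  have "(\<Prod>a\<in>insert a A. fischer (k a) (f a) (f a)) \<le>
      fischer (k a) (f a) (f a) * fischer (sum k A) (\<lambda>x. \<Prod>a\<in>A. f a x) (\<lambda>x. \<Prod>a\<in>A. f a x)"
    using insert by (simp add: mult_left_mono fischer_self_nonneg)
  also have "\<dots> \<le> fischer (k a + sum k A) (\<lambda>x. f a x * (\<Prod>a\<in>A. f a x)) (\<lambda>x. f a x * (\<Prod>a\<in>A. f a x))"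
    by (intro fischer_mult_ge form_prod insert) auto
  finally show ?case using insert by simp
qed simp

section \<open>Gaussian integrals of forms\<close>

text \<open>One-dimensional integration by parts, tested on powers and read off from the known moments. For
  $a = 0$ both sides vanish, so the value of the truncated exponent does not matter.\<close>

lemma normal_moment_Suc:
  "(\<integral>t. std_normal_density t * t ^ Suc a \<partial>lborel) =
    real a * (\<integral>t. std_normal_density t * t ^ (a - 1) \<partial>lborel)"
proof (cases "even a")
  case True
  then obtain b where b: "a = 2 * b" by (elim evenE)
  show ?thesis
  proof (cases b)
    case 0
    then show ?thesis using integral_std_normal_moment_odd[of 0] b by simp
  next
    case (Suc c)
    then show ?thesis
      using integral_std_normal_moment_odd[of b] integral_std_normal_moment_odd[of c] b by simp
  qed
next
  case False
  then obtain b where b: "a = 2 * b + 1" by (elim oddE)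
  have "fact (2 * Suc b) = (2 * real b + 2) * (2 * real b + 1) * fact (2 * b)"
    by (simp add: algebra_simps)
  then have "fact (2 * Suc b) / (2 ^ Suc b * fact (Suc b)) = real a * (fact (2 * b) / (2 ^ b * fact b))"
    unfolding b by (simp add: divide_simps)
  then show ?thesis
    using integral_std_normal_moment_even[of "Suc b"] integral_std_normal_moment_even[of b] b by simp
qed

lemma normal_moment_0: "(\<integral>t. std_normal_density t * t ^ 0 \<partial>lborel) = 1"
  using integral_std_normal_moment_even[of 0] by simp

lemma gauss_density_eq_prod:
  fixes x :: "real ^ 'n::finite"
  shows "(2 * pi) powr (- real CARD('n) / 2) * exp (- (norm x)\<^sup>2 / 2) =
    (\<Prod>i\<in>UNIV. std_normal_density (x $ i))"
proof -
  have "(2 * pi) powr (- real CARD('n) / 2) = ((2 * pi) powr (- (1 / 2))) powr real CARD('n)"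
    by (simp add: powr_powr)
  also have "(2 * pi) powr (- (1 / 2)) = 1 / sqrt (2 * pi)"
    using powr_minus_divide[of "2 * pi" "1 / 2"] powr_half_sqrt[of "2 * pi"] by simp
  also have "(1 / sqrt (2 * pi)) powr real CARD('n) = (1 / sqrt (2 * pi)) ^ CARD('n)"
    by (rule powr_realpow) simp
  finally have 1: "(2 * pi) powr (- real CARD('n) / 2) = (1 / sqrt (2 * pi)) ^ CARD('n)" .
  have 2: "exp (- (norm x)\<^sup>2 / 2) = (\<Prod>i\<in>UNIV. exp (- (x $ i)\<^sup>2 / 2))"
    by (simp add: norm_vec_def L2_set_def sum_nonneg sum_negf sum_divide_distrib flip: exp_sum)
  show ?thesis
    unfolding 1 2 std_normal_density_def prod.distrib prod_constant ..
qed

text \<open>Lebesgue measure on a Euclidean space is the image of a product measure indexed by the basis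
  vectors. The proof is Fubini's theorem for that product, together with a reindexing of the basis by
  the coordinates.\<close>

lemma
  fixes g :: "'n::finite \<Rightarrow> real \<Rightarrow> real"
  assumes g: "\<And>i. integrable lborel (g i)"
  shows integrable_lborel_prod_coord: "integrable lborel (\<lambda>x :: real ^ 'n. \<Prod>i\<in>UNIV. g i (x $ i))" (is ?I)
    and integral_lborel_prod_coord:
      "(\<integral>(x :: real ^ 'n). (\<Prod>i\<in>UNIV. g i (x $ i)) \<partial>lborel) = (\<Prod>i\<in>UNIV. integral\<^sup>L lborel (g i))" (is ?E)
proof -
  interpret product_sigma_finite "\<lambda>b :: real ^ 'n. lborel :: real measure" ..
  have g_measurable [measurable]: "g i \<in> borel_measurable borel" for i
    using borel_measurable_integrable[OF g] by simp
  define G where "G b = g (inv (\<lambda>i. axis i 1) b)" for b :: "real ^ 'n"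
  have inj: "inj (\<lambda>i :: 'n. axis i (1 :: real))"
    by (auto simp: inj_on_def axis_eq_axis)
  have B: "(Basis :: (real ^ 'n) set) = (\<lambda>i. axis i 1) ` UNIV"
    by (auto simp: Basis_vec_def)
  have G: "G (axis i 1) = g i" for i
    unfolding G_def by (subst inv_f_f[OF inj]) (rule refl)
  have Gi: "integrable lborel (G b)" for b
    unfolding G_def by (rule g)
  have *: "(\<Prod>i\<in>UNIV. g i ((\<Sum>b\<in>Basis. f b *\<^sub>R b) $ i)) = (\<Prod>b\<in>Basis. G b (f b))"
    for f :: "real ^ 'n \<Rightarrow> real"
  proof -
    have "(\<Sum>b\<in>Basis. f b *\<^sub>R b) $ i = f (axis i 1)" for i
      by (simp add: cart_eq_inner_axis inner_sum_left inner_Basis if_distrib cong: if_cong)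
    then show ?thesis
      unfolding B by (subst prod.reindex[OF inj]) (simp add: G)
  qed
  have 1: "integrable (\<Pi>\<^sub>M b\<in>Basis. lborel) (\<lambda>f. \<Prod>b\<in>(Basis :: (real ^ 'n) set). G b (f b))"
    by (rule product_integrable_prod) (auto intro: Gi)
  have 2: "(\<integral>f. (\<Prod>b\<in>Basis. G b (f b)) \<partial>(\<Pi>\<^sub>M b\<in>(Basis :: (real ^ 'n) set). lborel)) =
      (\<Prod>b\<in>Basis. integral\<^sup>L lborel (G b))"
    by (rule product_integral_prod) (auto intro: Gi)
  show ?I
    unfolding lborel_eq[where 'a = "real ^ 'n"]
    by (subst integrable_distr_eq) (simp_all only: * 1, simp_all)
  have "(\<integral>(x :: real ^ 'n). (\<Prod>i\<in>UNIV. g i (x $ i)) \<partial>lborel) =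
      (\<Prod>b\<in>(Basis :: (real ^ 'n) set). integral\<^sup>L lborel (G b))"
    unfolding lborel_eq[where 'a = "real ^ 'n"]
    by (subst integral_distr) (simp_all only: * 2, simp_all)
  also have "\<dots> = (\<Prod>i\<in>UNIV. integral\<^sup>L lborel (g i))"
    unfolding B by (subst prod.reindex[OF inj]) (simp add: G)
  finally show ?E .
qed

lemma measurable_monomial [measurable]: "monomial \<alpha> \<in> borel_measurable borel"
  unfolding monomial_def by measurable

lemma
  fixes \<alpha> :: "'n::finite \<Rightarrow> nat"
  shows integrable_gauss_monomial: "integrable gauss_measure (monomial \<alpha>)" (is ?I)
    and integral_gauss_monomial: "(\<integral>x. monomial \<alpha> x \<partial>gauss_measure) =
      (\<Prod>i\<in>UNIV. \<integral>t. std_normal_density t * t ^ \<alpha> i \<partial>lborel)" (is ?E)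
proof -
  have *: "(2 * pi) powr (- real CARD('n) / 2) * exp (- (norm x)\<^sup>2 / 2) * monomial \<alpha> x =
      (\<Prod>i\<in>UNIV. std_normal_density (x $ i) * (x $ i) ^ \<alpha> i)" for x :: "real ^ 'n"
    unfolding gauss_density_eq_prod monomial_def prod.distrib ..
  have g: "integrable lborel (\<lambda>t. std_normal_density t * t ^ \<alpha> i)" for i
    by (rule integrable_std_normal_moment)
  show ?I
    unfolding gauss_measure_def
    by (subst integrable_density)
      (simp_all only: real_scaleR_def * integrable_lborel_prod_coord[OF g], simp_all)
  show ?E
    unfolding gauss_measure_def
    by (subst integral_density)
      (simp_all only: real_scaleR_def * integral_lborel_prod_coord[OF g], simp_all)
qed

lemma integrable_gauss_form: "form k f \<Longrightarrow> integrable gauss_measure f"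
  by (induction rule: form.induct) (auto intro: integrable_gauss_monomial)

lemma integral_gauss_const: "(\<integral>(x :: real ^ 'n::finite). (c :: real) \<partial>gauss_measure) = c"
proof -
  have "(\<integral>(x :: real ^ 'n). c * monomial (\<lambda>_. 0) x \<partial>gauss_measure) = c"
    by (subst integral_mult_right_zero) (simp only: integral_gauss_monomial normal_moment_0 prod.neutral_const mult_1_right)
  then show ?thesis by (simp add: monomial_def)
qed

text \<open>Both sides are linear in $f$ and split over the coordinates when $f$ is a monomial, which leaves
  the one-dimensional recursion for moments in the $i$-th coordinate.\<close>

lemma gauss_integral_by_parts:
  fixes f :: "real ^ 'n::finite \<Rightarrow> real"
  shows "form k f \<Longrightarrow>
    (\<integral>x. x $ i * f x \<partial>gauss_measure) = (\<integral>x. partial_deriv i f x \<partial>gauss_measure)"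
proof (induction rule: form.induct)
  case (monomial \<alpha> k c)
  define M where "M a = (\<integral>t. std_normal_density t * t ^ a \<partial>lborel)" for a
  define R where "R = (\<Prod>j\<in>UNIV - {i}. M (\<alpha> j))"
  have remove: "(\<Prod>j\<in>UNIV. M ((\<alpha>(i := a)) j)) = M a * R" for a
    unfolding R_def by (subst prod.remove[of _ i]) (auto intro!: prod.cong)
  have "(\<lambda>x :: real ^ 'n. x $ i * (c * monomial \<alpha> x)) = (\<lambda>x. c * monomial (\<alpha>(i := Suc (\<alpha> i))) x)"
    unfolding monomial_def
    by (rule ext, subst (1 2) prod.remove[of _ i]) (auto intro!: prod.cong)
  then have "(\<integral>x. x $ i * (c * monomial \<alpha> x) \<partial>gauss_measure) = c * (M (Suc (\<alpha> i)) * R)"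
    by (simp add: integral_gauss_monomial remove del: fun_upd_apply flip: M_def)
  also have "\<dots> = c * real (\<alpha> i) * (M (\<alpha> i - 1) * R)"
    using normal_moment_Suc[of "\<alpha> i"] by (simp add: M_def)
  also have "\<dots> = (\<integral>x. partial_deriv i (\<lambda>x. c * monomial \<alpha> x) x \<partial>gauss_measure)"
    unfolding partial_deriv_monomial
    by (simp add: integral_gauss_monomial remove del: fun_upd_apply flip: M_def)
  finally show ?case .
next
  case (add k f g)
  then show ?case
    by (simp add: partial_deriv_add[of k f k g] distrib_left
        integrable_gauss_form[OF form_coord_mult] integrable_gauss_form[OF form_partial_deriv])
qed

section \<open>The Fischer norm and the Gaussian norm\<close>

text \<open>Write $k f$ as $\sum_i x_i \partial_i f$ and integrate by parts. This identity plays for the Gaussian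
  integral the role that the recursive definition plays for the Fischer product; the term with the
  Laplacian is what distinguishes the two.\<close>

lemma gauss_Euler:
  fixes f g :: "real ^ 'n::finite \<Rightarrow> real"
  assumes f: "form k f" and g: "form l g"
  shows "real k * (\<integral>x. f x * g x \<partial>gauss_measure) =
    (\<integral>x. laplacian f x * g x \<partial>gauss_measure) +
    (\<Sum>i\<in>UNIV. \<integral>x. partial_deriv i f x * partial_deriv i g x \<partial>gauss_measure)"
proof -
  note D = form_partial_deriv and I = integrable_gauss_form
  have fg: "form (k - 1 + l) (\<lambda>x. partial_deriv i f x * g x)" for i
    by (intro form_mult D f g)
  have "real k * (\<integral>x. f x * g x \<partial>gauss_measure) = (\<integral>x. real k * f x * g x \<partial>gauss_measure)"
    by (simp add: mult.assoc)
  also have "\<dots> = (\<integral>x. (\<Sum>i\<in>UNIV. x $ i * (partial_deriv i f x * g x)) \<partial>gauss_measure)"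
    unfolding Euler_identity[OF f, symmetric] sum_distrib_right mult.assoc ..
  also have "\<dots> = (\<Sum>i\<in>UNIV. \<integral>x. partial_deriv i (\<lambda>x. partial_deriv i f x * g x) x \<partial>gauss_measure)"
    by (subst Bochner_Integration.integral_sum)
      (auto intro!: I form_coord_mult fg sum.cong gauss_integral_by_parts[OF fg])
  also have "\<dots> = (\<Sum>i\<in>UNIV. (\<integral>x. partial_deriv i (partial_deriv i f) x * g x \<partial>gauss_measure) +
      (\<integral>x. partial_deriv i f x * partial_deriv i g x \<partial>gauss_measure))"
    unfolding partial_deriv_mult[OF D[OF f] g]
    by (intro sum.cong refl Bochner_Integration.integral_add
        I[OF form_mult[OF D[OF D[OF f]] g]] I[OF form_mult[OF D[OF f] D[OF g]]])
  also have "\<dots> = (\<integral>x. laplacian f x * g x \<partial>gauss_measure) +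
      (\<Sum>i\<in>UNIV. \<integral>x. partial_deriv i f x * partial_deriv i g x \<partial>gauss_measure)"
    unfolding laplacian_def sum_distrib_right sum.distrib
    by (subst Bochner_Integration.integral_sum)
      (rule I[OF form_mult[OF D[OF D[OF f]] g]], rule refl)
  finally show ?thesis .
qed

lemma laplacian_eq: "laplacian f = (\<lambda>x. \<Sum>i\<in>UNIV. partial_deriv i (partial_deriv i f) x)"
  by (rule ext) (simp add: laplacian_def)

lemma form_laplacian: "form k f \<Longrightarrow> form (k - 2) (laplacian f)"
  unfolding laplacian_eq
  using form_partial_deriv[OF form_partial_deriv, of k f]
  by (intro form_sum) (simp add: numeral_2_eq_2)

lemma laplacian_low_degree: "form k f \<Longrightarrow> k < 2 \<Longrightarrow> laplacian f = (\<lambda>x. 0)"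
  using form_partial_deriv[of k f]
  by (auto simp: laplacian_eq partial_deriv_form_0 less_2_cases_iff)

lemma laplacian_partial_deriv:
  assumes "form k f"
  shows "laplacian (partial_deriv i f) = partial_deriv i (laplacian f)"
proof -
  have "partial_deriv j (partial_deriv j (partial_deriv i f)) =
      partial_deriv i (partial_deriv j (partial_deriv j f))" for j
    using partial_deriv_commute[OF assms, of j i]
      partial_deriv_commute[OF form_partial_deriv[OF assms], of j i j] by simp
  moreover have "partial_deriv i (laplacian f) = (\<lambda>x. \<Sum>j\<in>UNIV. partial_deriv i (partial_deriv j (partial_deriv j f)) x)"
    unfolding laplacian_eq
    by (intro partial_deriv_sum) (auto intro!: form_partial_deriv assms)
  ultimately show ?thesis by (simp add: laplacian_eq)
qed

lemma form_laplacian_power: "form k f \<Longrightarrow> form (k - 2 * i) ((laplacian ^^ i) f)"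
  by (induction i) (use form_laplacian in force)+

lemma laplacian_power_partial_deriv:
  "form k f \<Longrightarrow> (laplacian ^^ j) (partial_deriv i f) = partial_deriv i ((laplacian ^^ j) f)"
  by (induction j) (simp_all add: laplacian_partial_deriv[OF form_laplacian_power])

lemma laplacian_power_eq_0:
  assumes "form k f" "k < 2 * i"
  shows "(laplacian ^^ i) f = (\<lambda>x. 0)"
  using assms(2)
proof (induction i)
  case (Suc i)
  show ?case
  proof (cases "k < 2 * i")
    case True
    then have "(laplacian ^^ Suc i) f = laplacian (\<lambda>x. 0)"
      using Suc.IH by simp
    then show ?thesis
      using laplacian_low_degree[OF form_zero[of 0]] by simp
  next
    case False
    then show ?thesis
      using laplacian_low_degree[OF form_laplacian_power[OF assms(1), of i]] Suc.prems by simp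
  qed
qed simp

text \<open>These integrals are the correction terms in the comparison of the two norms. The identity above,
  applied to $\Delta^i f$, expresses the integral by the one with $i + 1$ in place of $i$ and by those
  for the partial derivatives of $f$. Hence the sign follows by induction on the gap $t$ between the two
  exponents, with an inner induction on the degree: for $t = 0$ the integrand is a square, and if
  the degree of $f$ is less than $2 (i + t)$ it vanishes. In the remaining cases the factor $k - 2 i$
  is positive.\<close>

lemma gauss_laplacian_power_nonneg:
  fixes f :: "real ^ 'n::finite \<Rightarrow> real"
  shows "form k f \<Longrightarrow> (\<integral>x. (laplacian ^^ i) f x * (laplacian ^^ (i + t)) f x \<partial>gauss_measure) \<ge> 0"
proof (induction t arbitrary: i k f)
  case 0
  then show ?case by simp
next
  case (Suc t)
  note outer = Suc.IH
  from Suc.prems show ?case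
  proof (induction k arbitrary: f)
    case 0
    then show ?case using laplacian_power_eq_0[of 0 f "i + Suc t"] by simp
  next
    case (Suc k)
    show ?case
    proof (cases "Suc k < 2 * (i + Suc t)")
      case True
      show ?thesis unfolding laplacian_power_eq_0[OF Suc.prems True] by simp
    next
      case False
      let ?L = "\<lambda>j f. (laplacian ^^ j) f"
      have "real (Suc k - 2 * i) * (\<integral>x. ?L i f x * ?L (i + Suc t) f x \<partial>gauss_measure) =
          (\<integral>x. laplacian (?L i f) x * ?L (i + Suc t) f x \<partial>gauss_measure) +
          (\<Sum>l\<in>UNIV. \<integral>x. partial_deriv l (?L i f) x * partial_deriv l (?L (i + Suc t) f) x \<partial>gauss_measure)"
        by (rule gauss_Euler) (rule form_laplacian_power[OF Suc.prems])+
      also have "\<dots> = (\<integral>x. ?L (Suc i) f x * ?L (Suc i + t) f x \<partial>gauss_measure) +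
          (\<Sum>l\<in>UNIV. \<integral>x. ?L i (partial_deriv l f) x * ?L (i + Suc t) (partial_deriv l f) x \<partial>gauss_measure)"
        unfolding laplacian_power_partial_deriv[OF Suc.prems] by simp
      also have "\<dots> \<ge> 0"
        by (intro add_nonneg_nonneg sum_nonneg outer[OF Suc.prems] Suc.IH
            form_Suc_partial_deriv Suc.prems)
      finally show ?thesis using False by (simp add: zero_le_mult_iff)
    qed
  qed
qed

text \<open>The two norms satisfy the same recursion, except that the Gaussian one has the additional term
  $\int f \Delta f \, d\gamma_n$, which is nonnegative.\<close>

lemma fischer_le_gauss:
  fixes f :: "real ^ 'n::finite \<Rightarrow> real"
  shows "form k f \<Longrightarrow> fischer k f f \<le> (\<integral>x. (f x)\<^sup>2 \<partial>gauss_measure)"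
proof (induction k arbitrary: f)
  case 0
  have "(\<lambda>x. (f x)\<^sup>2) = (\<lambda>x. (f 0)\<^sup>2)"
    by (rule ext, rule arg_cong[where f = "\<lambda>y. y\<^sup>2"]) (rule form_0_eq[OF 0 refl])
  then show ?case by (simp only: integral_gauss_const fischer.simps power2_eq_square)
next
  case (Suc k)
  have "real (Suc k) * fischer (Suc k) f f = (\<Sum>i\<in>UNIV. fischer k (partial_deriv i f) (partial_deriv i f))"
    by simp
  also have "\<dots> \<le> (\<Sum>i\<in>UNIV. \<integral>x. (partial_deriv i f x)\<^sup>2 \<partial>gauss_measure)"
    by (intro sum_mono Suc.IH form_Suc_partial_deriv Suc.prems)
  also have "\<dots> \<le> (\<integral>x. laplacian f x * f x \<partial>gauss_measure) + \<dots>"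
    using gauss_laplacian_power_nonneg[OF Suc.prems, of 0 1] by (simp add: mult.commute)
  also have "\<dots> = real (Suc k) * (\<integral>x. (f x)\<^sup>2 \<partial>gauss_measure)"
    using gauss_Euler[OF Suc.prems Suc.prems] by (simp add: power2_eq_square)
  finally show ?case by (rule mult_left_le_imp_le) simp
qed

text \<open>For harmonic $f$ the additional term is zero, and the derivatives of $f$ are harmonic again.\<close>

lemma harmonic_gauss_eq_fischer:
  fixes f :: "real ^ 'n::finite \<Rightarrow> real"
  shows "form k f \<Longrightarrow> form k g \<Longrightarrow> laplacian f = (\<lambda>x. 0) \<Longrightarrow>
    (\<integral>x. f x * g x \<partial>gauss_measure) = fischer k f g"
proof (induction k arbitrary: f g)
  case 0
  have "(\<lambda>x. f x * g x) = (\<lambda>x. f 0 * g 0)"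
    by (rule ext, rule arg_cong2[where f = "(*)"]) (rule form_0_eq[OF 0(1) refl] form_0_eq[OF 0(2) refl])+
  then show ?case by (simp only: integral_gauss_const fischer.simps)
next
  case (Suc k)
  have "laplacian (partial_deriv i f) = (\<lambda>x. 0)" for i
    using laplacian_partial_deriv[OF Suc.prems(1)] Suc.prems(3) by (simp add: partial_deriv_const)
  then have "real (Suc k) * (\<integral>x. f x * g x \<partial>gauss_measure) =
      (\<Sum>i\<in>UNIV. fischer k (partial_deriv i f) (partial_deriv i g))"
    unfolding gauss_Euler[OF Suc.prems(1,2)] Suc.prems(3)
    by (simp add: Suc.IH form_Suc_partial_deriv Suc.prems)
  then show ?case by (simp add: field_simps)
qed

section \<open>Radial moments, eigenfunctions and the sphere\<close>

lemma norm_power_Suc: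
  "norm x ^ (2 * Suc K) = (\<Sum>i\<in>UNIV. x $ i * (x $ i * norm x ^ (2 * K)))" for x :: "real ^ 'n::finite"
proof -
  have "(norm x)\<^sup>2 = (\<Sum>i\<in>UNIV. x $ i * x $ i)"
    by (simp add: power2_norm_eq_inner inner_vec_def)
  then show ?thesis
    by (simp add: power2_eq_square sum_distrib_right flip: mult.assoc)
qed

lemma form_norm_power: "form (2 * K) (\<lambda>x :: real ^ 'n::finite. norm x ^ (2 * K))"
proof (induction K)
  case 0
  show ?case using form_const[of 1] by simp
next
  case (Suc K)
  show ?case
    unfolding norm_power_Suc
    by (intro form_sum) (use form_coord_mult[OF form_coord_mult[OF Suc]] in simp)
qed

text \<open>Integrating $\|x\|^{2K+2} = \sum_i x_i \, (x_i \|x\|^{2K})$ by parts multiplies the moment by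
  $n + 2K = 2 (K + n/2)$, which is the functional equation of the Gamma function up to the factor $2$.\<close>

lemma gauss_norm_moment:
  "(\<integral>(x :: real ^ 'n::finite). norm x ^ (2 * K) \<partial>gauss_measure) =
    2 ^ K * Gamma (real K + real CARD('n) / 2) / Gamma (real CARD('n) / 2)"
proof (induction K)
  case 0
  have "Gamma (real CARD('n) / 2) > 0" by (intro Gamma_real_pos) simp
  then have "Gamma (real CARD('n) / 2) \<noteq> 0" by linarith
  then show ?case using integral_gauss_const[of 1, where 'n = 'n] by simp
next
  case (Suc K)
  define N :: "real ^ 'n \<Rightarrow> real" where "N x = norm x ^ (2 * K)" for x
  have N: "form (2 * K) N"
    unfolding N_def by (rule form_norm_power)
  note I = integrable_gauss_form
  have "(\<integral>(x :: real ^ 'n). norm x ^ (2 * Suc K) \<partial>gauss_measure) =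
      (\<integral>x. (\<Sum>i\<in>UNIV. x $ i * (x $ i * N x)) \<partial>gauss_measure)"
    unfolding norm_power_Suc N_def ..
  also have "\<dots> = (\<Sum>i\<in>UNIV. \<integral>x. partial_deriv i (\<lambda>x. x $ i * N x) x \<partial>gauss_measure)"
    by (subst Bochner_Integration.integral_sum)
      (auto intro!: I form_coord_mult N sum.cong gauss_integral_by_parts)
  also have "\<dots> = (\<integral>x. (\<Sum>i\<in>UNIV. partial_deriv i (\<lambda>x. x $ i * N x) x) \<partial>gauss_measure)"
    by (subst Bochner_Integration.integral_sum)
      (auto intro!: I form_partial_deriv form_coord_mult N)
  also have "\<dots> = (\<integral>x. (real CARD('n) + real (2 * K)) * N x \<partial>gauss_measure)"
    by (simp add: partial_deriv_coord_mult[OF N] sum.distrib Euler_identity[OF N] distrib_right)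
  also have "\<dots> = (real CARD('n) + real (2 * K)) * (\<integral>x. N x \<partial>gauss_measure)"
    by simp
  also have "\<dots> = 2 ^ Suc K * ((real K + real CARD('n) / 2) * Gamma (real K + real CARD('n) / 2)) / Gamma (real CARD('n) / 2)"
  proof -
    have "real CARD('n) + real (2 * K) = 2 * (real K + real CARD('n) / 2)" by simp
    then show ?thesis unfolding N_def Suc by simp
  qed
  also have "(real K + real CARD('n) / 2) * Gamma (real K + real CARD('n) / 2) =
      Gamma (real K + real CARD('n) / 2 + 1)"
  proof (rule Gamma_plus1[symmetric])
    have "real K + real CARD('n) / 2 > 0" by (simp add: add_nonneg_pos)
    then show "real K + real CARD('n) / 2 \<notin> \<int>\<^sub>\<le>\<^sub>0"
      by (auto elim!: nonpos_Ints_cases)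
  qed
  finally show ?case by (simp add: add_ac)
qed

text \<open>By Euler's identity the eigenvalue equation is $\Delta f = (m - k) f$. Here the left-hand side is
  homogeneous of degree $m - 2$ and the right-hand side of degree $m$; comparing the values at
  $x$ and $2x$ shows that both vanish, so that $m = k$ unless $f$ is zero.\<close>

lemma OU_eigenfunction_form:
  assumes f: "form m f" and OU: "\<And>x. OU f x = - real k * f x"
  shows "laplacian f = (\<lambda>x. 0)" and "f y \<noteq> 0 \<Longrightarrow> m = k"
proof -
  have L: "laplacian f x = (real m - real k) * f x" for x
    using OU[of x] Euler_identity[OF f, of x]
    by (simp add: OU_def gradient_def inner_vec_def algebra_simps)
  have "4 * laplacian f (2 *\<^sub>R x) = 2 ^ m * laplacian f x" for x
  proof (cases "m < 2")
    case True
    then show ?thesis using laplacian_low_degree[OF f] by simp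
  next
    case False
    then obtain l where m: "m = Suc (Suc l)"
      by (metis Suc_le_eq add_2_eq_Suc le_Suc_ex not_less)
    then show ?thesis
      using form_scale[OF form_laplacian[OF f], of 2 x] by simp
  qed
  moreover have "laplacian f (2 *\<^sub>R x) = 2 ^ m * laplacian f x" for x
    unfolding L form_scale[OF f] by simp
  ultimately have "laplacian f x = 0" for x
    by (smt (verit) mult_eq_0_iff zero_less_power)
  then show "laplacian f = (\<lambda>x. 0)" by blast
  with L show "f y \<noteq> 0 \<Longrightarrow> m = k" by (metis mult_eq_0_iff of_nat_eq_iff eq_iff_diff_eq_0)
qed

lemma axis_in_sphere: "axis i 1 \<in> sphere (0 :: real ^ 'n::finite) 1"
  by simp

lemma form_le_fischer_sphere:
  assumes "form k f" "x \<in> sphere 0 1"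
  shows "\<bar>f x\<bar> \<le> sqrt (fischer k f f / fact k)"
proof -
  have "(f x)\<^sup>2 \<le> fischer k f f / fact k"
    using form_le_fischer[OF assms(1), of x] assms(2) by (simp add: field_simps)
  then show ?thesis using real_le_rsqrt real_sqrt_le_mono by fastforce
qed

lemma form_le_SUP_sphere:
  fixes f :: "real ^ 'n::finite \<Rightarrow> real"
  assumes "form k f"
  shows "\<bar>f x\<bar> \<le> norm x ^ k * (SUP y\<in>sphere 0 1. \<bar>f y\<bar>)"
proof -
  \<comment> \<open>At the origin any unit vector serves; this also covers forms of degree zero.\<close>
  obtain y :: "real ^ 'n" where y: "y \<in> sphere 0 1" "x = norm x *\<^sub>R y"
  proof (cases "x = 0")
    case True
    with that[OF axis_in_sphere[of undefined]] show ?thesis by simp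
  next
    case False
    then show ?thesis using that[of "inverse (norm x) *\<^sub>R x"] by simp
  qed
  have "bdd_above ((\<lambda>y. \<bar>f y\<bar>) ` sphere 0 1)"
    using form_le_fischer_sphere[OF assms] by (intro bdd_aboveI2)
  then have "\<bar>f y\<bar> \<le> (SUP y\<in>sphere 0 1. \<bar>f y\<bar>)"
    by (rule cSUP_upper[OF y(1)])
  moreover have "\<bar>f x\<bar> = norm x ^ k * \<bar>f y\<bar>"
    by (subst y(2)) (simp add: form_scale[OF assms] abs_mult)
  ultimately show ?thesis by (simp add: mult_left_mono)
qed

theorem theorem1p5:
  fixes d :: nat
    and F :: "nat \<Rightarrow> real ^ 'n::finite \<Rightarrow> real"
    and k :: "nat \<Rightarrow> nat"
  assumes "d \<ge> 1"
    and "\<And>i. i \<in> {1..d} \<Longrightarrow> homogeneous_polynomial (F i)"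
    and "\<And>i. i \<in> {1..d} \<Longrightarrow> k i \<ge> 1"
    and "\<And>i x. i \<in> {1..d} \<Longrightarrow> OU (F i) x = - real (k i) * F i x"
    and "\<And>i. i \<in> {1..d} \<Longrightarrow> (\<integral>x. (F i x)\<^sup>2 \<partial>gauss_measure) = 1"
  defines "K \<equiv> (\<Sum>i=1..d. k i)"
    and "S\<^sub>i \<equiv> (\<lambda>i. SUP x\<in>sphere 0 1. \<bar>F i x\<bar>)"
    and "S \<equiv> (SUP x\<in>sphere 0 1. \<Prod>i=1..d. \<bar>F i x\<bar>)"
  shows "S * sqrt (2 ^ K * Gamma (real K + real CARD('n) / 2)
                   / (Gamma (real CARD('n) / 2) * (\<Prod>i=1..d. fact (k i))))
         \<ge> (\<Prod>i=1..d. S\<^sub>i i)"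
proof -
  have harmonic: "form (k i) (F i) \<and> laplacian (F i) = (\<lambda>x. 0)" if i: "i \<in> {1..d}" for i
  proof -
    obtain m where m: "form m (F i)"
      using homogeneous_polynomial_imp_form assms(2)[OF i] by blast
    \<comment> \<open>The zero form would be an eigenfunction for every eigenvalue; the normalisation excludes it.\<close>
    have "\<exists>x. F i x \<noteq> 0"
    proof (rule ccontr)
      assume "\<nexists>x. F i x \<noteq> 0"
      then show False using assms(5)[OF i] by simp
    qed
    then show ?thesis
      using OU_eigenfunction_form[OF m assms(4)[OF i]] m by blast
  qed
  have form: "form (k i) (F i)" if "i \<in> {1..d}" for i
    using harmonic[OF that] ..
  have norm1: "fischer (k i) (F i) (F i) = 1" if i: "i \<in> {1..d}" for i
    using harmonic_gauss_eq_fischer[of "k i" "F i" "F i"] harmonic[OF i] assms(5)[OF i]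
    by (simp add: power2_eq_square)
  define P where "P x = (\<Prod>i=1..d. F i x)" for x
  define M where "M = 2 ^ K * Gamma (real K + real CARD('n) / 2) / Gamma (real CARD('n) / 2)"
  define G :: real where "G = (\<Prod>i=1..d. fact (k i))"
  have P: "form K P"
    unfolding K_def P_def by (rule form_prod) (rule form)
  have S: "S = (SUP x\<in>sphere 0 1. \<bar>P x\<bar>)"
    unfolding S_def P_def by (simp add: abs_prod)
  have bound: "\<bar>P x\<bar> \<le> norm x ^ K * S" for x
    unfolding S by (rule form_le_SUP_sphere[OF P])
  have S_nonneg: "S \<ge> 0"
    using bound[of "axis undefined 1"] abs_ge_zero[of "P (axis undefined 1)"] by simp
  have "1 = (\<Prod>i=1..d. fischer (k i) (F i) (F i))"
    by (simp add: norm1)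
  also have "\<dots> \<le> fischer K P P"
    unfolding K_def P_def by (rule fischer_prod_ge) (auto intro: form)
  also have "\<dots> \<le> (\<integral>x. (P x)\<^sup>2 \<partial>gauss_measure)"
    by (rule fischer_le_gauss[OF P])
  also have "\<dots> \<le> (\<integral>(x :: real ^ 'n). S\<^sup>2 * norm x ^ (2 * K) \<partial>gauss_measure)"
  proof (rule Bochner_Integration.integral_mono)
    show "integrable gauss_measure (\<lambda>x. (P x)\<^sup>2)"
      using integrable_gauss_form[OF form_mult[OF P P]] by (simp add: power2_eq_square)
    show "integrable gauss_measure (\<lambda>x :: real ^ 'n. S\<^sup>2 * norm x ^ (2 * K))"
      by (rule integrable_gauss_form[OF form_cmult[OF form_norm_power]])
    show "(P x)\<^sup>2 \<le> S\<^sup>2 * norm x ^ (2 * K)" for x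
      using power_mono[OF bound[of x] abs_ge_zero, of 2]
      by (simp add: power_mult_distrib mult.commute flip: power_mult)
  qed
  also have "\<dots> = S\<^sup>2 * M"
    by (simp add: gauss_norm_moment M_def)
  finally have "1 \<le> S * sqrt M"
    using S_nonneg by (metis real_sqrt_abs real_sqrt_ge_one real_sqrt_mult abs_of_nonneg)
  have S\<^sub>i_le: "0 \<le> S\<^sub>i i \<and> S\<^sub>i i \<le> 1 / sqrt (fact (k i))" if i: "i \<in> {1..d}" for i
  proof
    show "S\<^sub>i i \<le> 1 / sqrt (fact (k i))"
      unfolding S\<^sub>i_def
      using form_le_fischer_sphere[OF form[OF i]] norm1[OF i] axis_in_sphere
      by (intro cSUP_least) (auto simp: real_sqrt_divide)
    show "0 \<le> S\<^sub>i i"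
      using form_le_SUP_sphere[OF form[OF i], of "axis undefined 1"]
        abs_ge_zero[of "F i (axis undefined 1)"] by (simp add: S\<^sub>i_def)
  qed
  have "(\<Prod>i=1..d. S\<^sub>i i) \<le> (\<Prod>i=1..d. 1 / sqrt (fact (k i)))"
    by (intro prod_mono S\<^sub>i_le)
  also have "\<dots> = 1 / sqrt G"
  proof -
    have "sqrt (\<Prod>i\<in>A. fact (k i)) = (\<Prod>i\<in>A. sqrt (fact (k i)))" for A
      by (induction A rule: infinite_finite_induct) (simp_all add: real_sqrt_mult)
    then show ?thesis by (simp add: G_def prod_dividef)
  qed
  also have "\<dots> \<le> S * sqrt M / sqrt G"
    using \<open>1 \<le> S * sqrt M\<close> by (intro divide_right_mono) (simp_all add: G_def prod_nonneg)
  also have "\<dots> = S * sqrt (M / G)"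
    by (simp add: real_sqrt_divide)
  finally show ?thesis
    by (simp add: M_def G_def)
qed

end
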